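(* Let $T>R>P>S$ be real numbers with $2R>T+S$, and let $\mathcal{S}\subset\mathbb{R}^2$ be the convex hull of $(R,R),(S,T),(T,S),(P,P)$. If $s^*=(s^*_X,s^*_Y)\in\mathcal{S}$ satisfies $P<s^*_X$ and $P<s^*_Y$, then there is a pair of Smale plans $\pi_X,\pi_Y$ which is a strong Nash equilibrium with $s^*$ the payoff to the pair.
   Context: Iterated Prisoner's Dilemma. In each round $n=1,2,\dots$ players X and Y simultaneously choose $c$ or $d$. Outcomes are written with X's choice first; outcomes $cc,cd,dc,dd$ give the payoff pairs $S^n=(S^n_X,S^n_Y)=(R,R),(S,T),(T,S),(P,P)$ respectively. Put $s^N=(s^N_X,s^N_Y)=\frac1N\sum_{n=1}^N S^n\in\mathcal{S}$. Let $\mathrm{Switch}(x,y)=(y,x)$. A Smale plan is a function $\pi:\mathcal{S}\to[0,1]$. If X uses $\pi$, then in round $N+1$ X plays $c$ with probability $\pi(s^N)$ (so surely $c$ if this is $1$, surely $d$ if it is $0$). If Y uses $\pi$, then in round $N+1$ Y plays $c$ with probability $\pi(\mathrm{Switch}(s^N))$. A player eventually plays a plan if there is $N^*$ such that the plan is used in round $N+1$ for all $N\ge N^*$; play before that is arbitrary. A player whose play is described as arbitrary may choose $c$ or $d$ in any way in each round. A pair of Smale plans $\pi_X,\pi_Y$ is a strong Nash equilibrium with payoff $s^*=(s_X^*,s_Y^* )$ when: (a) if X eventually plays $\pi_X$ and Y eventually plays $\pi_Y$, then the sequence $\{s^N\}$ converges to $s^*$; (b') if Y eventually plays $\pi_Y$,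 then, regardless of the play of X, the only possible limit point $V=(V_X,V_Y)$ of the sequence $\{s^N\}$ with $V_X\ge s^*_X$ is $V=s^*$; and if X eventually plays $\pi_X$, then, regardless of the play of Y, the only possible limit point $V$ of $\{s^N\}$ with $V_Y\ge s^*_Y$ is $V=s^*$. *)

theory Defs
  imports "HOL-Probability.Probability"
begin

datatype move = Coop | Defect

type_synonym outcome = "move \<times> move"

text \<open>An outcome is (X's move, Y's move); a payoff is (X's payoff, Y's payoff).
  \<^const>\<open>prod.swap\<close> is the map \<open>Switch\<close>.\<close>

fun payoff :: "real \<Rightarrow> real \<Rightarrow> real \<Rightarrow> real \<Rightarrow> outcome \<Rightarrow> real \<times> real" where
  "payoff R S T P (Coop, Coop) = (R, R)"
| "payoff R S T P (Coop, Defect) = (S, T)"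
| "payoff R S T P (Defect, Coop) = (T, S)"
| "payoff R S T P (Defect, Defect) = (P, P)"

definition payoff_region :: "real \<Rightarrow> real \<Rightarrow> real \<Rightarrow> real \<Rightarrow> (real \<times> real) set" where
  "payoff_region R S T P = convex hull {(R, R), (S, T), (T, S), (P, P)}"

text \<open>A run of the game is a sequence \<open>\<omega>\<close> in which \<open>\<omega> n\<close> is the outcome of round \<open>n + 1\<close>, so
  the average over the first \<open>N\<close> rounds depends on \<open>\<omega> 0, \<dots>, \<omega> (N - 1)\<close>. It is
  meaningful for \<open>N \<ge> 1\<close>.\<close>

definition avg_payoff ::
    "real \<Rightarrow> real \<Rightarrow> real \<Rightarrow> real \<Rightarrow> (nat \<Rightarrow> outcome) \<Rightarrow> nat \<Rightarrow> real \<times> real" where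
  "avg_payoff R S T P \<omega> N = (1 / real N) *\<^sub>R (\<Sum>n<N. payoff R S T P (\<omega> n))"

definition smale_plan ::
    "real \<Rightarrow> real \<Rightarrow> real \<Rightarrow> real \<Rightarrow> (real \<times> real \<Rightarrow> real) \<Rightarrow> bool" where
  "smale_plan R S T P \<pi> \<longleftrightarrow> \<pi> \<in> payoff_region R S T P \<rightarrow> {0..1}"

text \<open>Random play of the two players is given by the law of the run.\<close>

definition play_law :: "(nat \<Rightarrow> outcome) measure \<Rightarrow> bool" where
  "play_law M \<longleftrightarrow> prob_space M \<and> sets M = sets (Pi\<^sub>M UNIV (\<lambda>_. count_space UNIV))"

text \<open>X uses \<open>\<pi>\<close> in round \<open>N + 1\<close>: given any outcomes \<open>h 0, \<dots>, h (N - 1)\<close> of the earlier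
  rounds, X cooperates with conditional probability \<open>\<pi> (s\<^sup>N)\<close>. Since the moves of a round are
  simultaneous, X's randomization is independent of Y's move in that round, so one may
  condition on Y's move \<open>b\<close> as well. The conditional probabilities are stated in product form, to
  cover histories of probability zero. No restriction is put on Y's behaviour.\<close>

definition uses_X ::
    "real \<Rightarrow> real \<Rightarrow> real \<Rightarrow> real \<Rightarrow> (nat \<Rightarrow> outcome) measure \<Rightarrow> (real \<times> real \<Rightarrow> real) \<Rightarrow> nat \<Rightarrow> bool" where
  "uses_X R S T P M \<pi> N \<longleftrightarrow>
     (\<forall>h b. measure M {\<omega> \<in> space M. (\<forall>n<N. \<omega> n = h n) \<and> \<omega> N = (Coop, b)} =
        \<pi> (avg_payoff R S T P h N) *
        measure M {\<omega> \<in> space M. (\<forall>n<N. \<omega> n = h n) \<and> snd (\<omega> N) = b})"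

definition uses_Y ::
    "real \<Rightarrow> real \<Rightarrow> real \<Rightarrow> real \<Rightarrow> (nat \<Rightarrow> outcome) measure \<Rightarrow> (real \<times> real \<Rightarrow> real) \<Rightarrow> nat \<Rightarrow> bool" where
  "uses_Y R S T P M \<pi> N \<longleftrightarrow>
     (\<forall>h a. measure M {\<omega> \<in> space M. (\<forall>n<N. \<omega> n = h n) \<and> \<omega> N = (a, Coop)} =
        \<pi> (prod.swap (avg_payoff R S T P h N)) *
        measure M {\<omega> \<in> space M. (\<forall>n<N. \<omega> n = h n) \<and> fst (\<omega> N) = a})"

text \<open>The bound \<open>N0 \<ge> 1\<close> reflects that no average is available before the first round.\<close>

definition eventually_plays_X ::
    "real \<Rightarrow> real \<Rightarrow> real \<Rightarrow> real \<Rightarrow> (nat \<Rightarrow> outcome) measure \<Rightarrow> (real \<times> real \<Rightarrow> real) \<Rightarrow> bool" where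
  "eventually_plays_X R S T P M \<pi> \<longleftrightarrow> (\<exists>N0\<ge>1. \<forall>N\<ge>N0. uses_X R S T P M \<pi> N)"

definition eventually_plays_Y ::
    "real \<Rightarrow> real \<Rightarrow> real \<Rightarrow> real \<Rightarrow> (nat \<Rightarrow> outcome) measure \<Rightarrow> (real \<times> real \<Rightarrow> real) \<Rightarrow> bool" where
  "eventually_plays_Y R S T P M \<pi> \<longleftrightarrow> (\<exists>N0\<ge>1. \<forall>N\<ge>N0. uses_Y R S T P M \<pi> N)"

definition seq_limit_point :: "(nat \<Rightarrow> 'a::topological_space) \<Rightarrow> 'a \<Rightarrow> bool" where
  "seq_limit_point x V \<longleftrightarrow> (\<exists>r. strict_mono r \<and> (x \<circ> r) \<longlonglongrightarrow> V)"

text \<open>Statements about the random sequence of averages are almost sure statements, for every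
  law of play. The laws include the point masses, so for plans with values in \<open>{0, 1}\<close> they hold
  for every single run that follows the plan.\<close>

definition strong_nash ::
    "real \<Rightarrow> real \<Rightarrow> real \<Rightarrow> real \<Rightarrow> (real \<times> real \<Rightarrow> real) \<Rightarrow> (real \<times> real \<Rightarrow> real) \<Rightarrow> real \<times> real \<Rightarrow> bool" where
  "strong_nash R S T P \<pi>X \<pi>Y s \<longleftrightarrow>
     (\<forall>M. play_law M \<and> eventually_plays_X R S T P M \<pi>X \<and> eventually_plays_Y R S T P M \<pi>Y \<longrightarrow>
        (AE \<omega> in M. avg_payoff R S T P \<omega> \<longlonglongrightarrow> s)) \<and>
     (\<forall>M. play_law M \<and> eventually_plays_Y R S T P M \<pi>Y \<longrightarrow>
        (AE \<omega> in M. \<forall>V. seq_limit_point (avg_payoff R S T P \<omega>) V \<and> fst V \<ge> fst s \<longrightarrow> V = s)) \<and>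
     (\<forall>M. play_law M \<and> eventually_plays_X R S T P M \<pi>X \<longrightarrow>
        (AE \<omega> in M. \<forall>V. seq_limit_point (avg_payoff R S T P \<omega>) V \<and> snd V \<ge> snd s \<longrightarrow> V = s))"

end

theory Submission
  imports Defs
begin

text \<open>Both plans have values 0 and 1. Player X cooperates exactly when the average payoff lies in a
  downward cone \<open>y - s\<^sub>Y \<le> - \<kappa> \<bar>x - s\<^sub>X\<bar>\<close> with apex \<open>s\<close>, and Y does the same with the
  coordinates exchanged. A cone is invariant under scaling, so the plans may be read as rules about
  the accumulated excess \<open>U\<^sub>N\<close>, the sum of \<open>payoff - s\<close> over the first \<open>N\<close> rounds, which
  is a walk with bounded steps.

  One plan alone punishes. When X defects, Y gets at most \<open>P < s\<^sub>Y\<close>, so for small \<open>\<kappa>\<close> the step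
  of the walk lies in X's cone. The function \<open>guard \<kappa>\<close> that defines the cone is sublinear, so it
  does not grow in rounds where X defects, that is, whenever it is positive; hence it stays bounded
  along the walk (\<open>guard_sum_bounded_above\<close>). After division by \<open>N\<close>, every limit point of the
  averages lies in the cone, and the apex \<open>s\<close> is the only point of the cone that gives Y at
  least \<open>s\<^sub>Y\<close>.

  Both plans together force \<open>U\<^sub>N\<close> to stay bounded, so the averages converge to \<open>s\<close> at the rate
  \<open>1 / N\<close>. By the first part \<open>U\<^sub>N\<close> stays near both cones, so its two coordinates are
  bounded above. For a lower bound, use that \<open>2 * R > T + S\<close> makes the segments from
  \<open>(R, R)\<close> to \<open>(T, S)\<close> and to \<open>(S, T)\<close> lie on the boundary of the payoff region. On the
  first segment Y cooperates, on the second X cooperates. So the outward normal functional of the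
  first segment cannot decrease along the walk while Y cooperates, and that of the second cannot
  decrease while X cooperates. The minimum of these two functionals is a potential that is bounded
  below: where it is very negative, either the walk is far from the diagonal, and then the player
  whose cooperation matters for the smaller functional does cooperate, or the walk is near the
  diagonal, deep inside both cones, and both cooperate (\<open>min_support_step\<close>).\<close>

section \<open>The cone plans\<close>

text \<open>The function is non-positive exactly on the cone with apex 0 that opens downwards. It is
  sublinear, and both properties of the plans rest on that.\<close>

definition guard :: "real \<Rightarrow> real \<times> real \<Rightarrow> real" where
  "guard \<kappa> v = snd v + \<kappa> * \<bar>fst v\<bar>"

lemma guard_add_le: "0 \<le> \<kappa> \<Longrightarrow> guard \<kappa> (v + w) \<le> guard \<kappa> v + guard \<kappa> w"
  using mult_left_mono[OF abs_triangle_ineq[of "fst v" "fst w"], of \<kappa>]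
  by (simp add: guard_def algebra_simps)

lemma guard_scaleR: "0 \<le> c \<Longrightarrow> guard \<kappa> (c *\<^sub>R v) = c * guard \<kappa> v"
  by (simp add: guard_def abs_mult algebra_simps)

lemma guard_scaleR_le_0_iff: "0 < c \<Longrightarrow> guard \<kappa> (c *\<^sub>R v) \<le> 0 \<longleftrightarrow> guard \<kappa> v \<le> 0"
  by (simp add: guard_scaleR mult_le_0_iff)

definition cone_plan :: "real \<Rightarrow> real \<times> real \<Rightarrow> real \<times> real \<Rightarrow> real" where
  "cone_plan \<kappa> s v = (if guard \<kappa> (v - s) \<le> 0 then 1 else 0)"

text \<open>The excess over the target \<open>s\<close> is kept as a sum and not as an average because its increments
  do not depend on the round.\<close>

definition excess ::
    "real \<Rightarrow> real \<Rightarrow> real \<Rightarrow> real \<Rightarrow> real \<times> real \<Rightarrow> (nat \<Rightarrow> outcome) \<Rightarrow> nat \<Rightarrow> real \<times> real" where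
  "excess R S T P s \<omega> N = (\<Sum>n<N. payoff R S T P (\<omega> n) - s)"

lemma avg_payoff_minus_target:
  assumes "N \<ge> 1"
  shows "avg_payoff R S T P \<omega> N - s = (1 / real N) *\<^sub>R excess R S T P s \<omega> N"
  using assms
  by (simp add: avg_payoff_def excess_def sum_subtractf sum_constant_scaleR scaleR_right_diff_distrib)

lemma prod_swap_diff: "prod.swap (a - b) = prod.swap a - prod.swap (b :: real \<times> real)"
  by (simp add: prod_eq_iff)

text \<open>A cone contains \<open>U\<^sub>N / N\<close> if and only if it contains \<open>U\<^sub>N\<close>. The average before the first
  round is the default value 0, which is why \<open>N \<ge> 1\<close> is required.\<close>

lemma cone_plan_X_iff:
  assumes "N \<ge> 1"
  shows "cone_plan \<kappa> s (avg_payoff R S T P \<omega> N) = 1 \<longleftrightarrow> guard \<kappa> (excess R S T P s \<omega> N) \<le> 0"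
  using assms
  by (simp add: cone_plan_def avg_payoff_minus_target guard_scaleR_le_0_iff)

lemma cone_plan_Y_iff:
  assumes "N \<ge> 1"
  shows "cone_plan \<kappa> (prod.swap s) (prod.swap (avg_payoff R S T P \<omega> N)) = 1
    \<longleftrightarrow> guard \<kappa> (prod.swap (excess R S T P s \<omega> N)) \<le> 0"
proof -
  have "prod.swap (avg_payoff R S T P \<omega> N) - prod.swap s
      = (1 / real N) *\<^sub>R prod.swap (excess R S T P s \<omega> N)"
    unfolding prod_swap_diff[symmetric] avg_payoff_minus_target[OF assms]
    by (simp add: prod_eq_iff)
  then show ?thesis
    using assms guard_scaleR_le_0_iff[of "1 / real N" \<kappa> "prod.swap (excess R S T P s \<omega> N)"]
    by (simp add: cone_plan_def)
qed

section \<open>Almost surely, a plan with values 0 and 1 dictates the moves\<close>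

lemma UNIV_move: "(UNIV :: move set) = {Coop, Defect}"
  using move.exhaust by auto

lemma finite_move: "finite (UNIV :: move set)"
  by (simp add: UNIV_move)

lemma finite_outcome: "finite (UNIV :: outcome set)"
  using finite_Prod_UNIV[OF finite_move finite_move] by simp

lemma cylinder_in_sets:
  assumes "play_law M"
  shows "{\<omega> \<in> space M. (\<forall>n<N. \<omega> n = h n) \<and> Q (\<omega> N)} \<in> sets M"
proof -
  have sets: "sets M = sets (Pi\<^sub>M UNIV (\<lambda>_. count_space (UNIV :: outcome set)))"
    using assms by (simp add: play_law_def)
  have "(\<lambda>\<omega>. \<omega> n) \<in> measurable (Pi\<^sub>M UNIV (\<lambda>_. count_space UNIV)) (count_space (UNIV :: outcome set))" for n
    by (rule measurable_component_singleton) simp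
  then have comp: "(\<lambda>\<omega>. \<omega> n) \<in> measurable M (count_space (UNIV :: outcome set))" for n
    unfolding measurable_cong_sets[OF sets refl] .
  have round: "{\<omega> \<in> space M. A (\<omega> n)} \<in> sets M" for A n
  proof -
    have "(\<lambda>\<omega>. \<omega> n) -` Collect A \<inter> space M \<in> sets M"
      by (rule measurable_sets[OF comp]) simp
    also have "(\<lambda>\<omega>. \<omega> n) -` Collect A \<inter> space M = {\<omega> \<in> space M. A (\<omega> n)}" by auto
    finally show ?thesis .
  qed
  have "{\<omega> \<in> space M. \<forall>n\<in>{..<N}. \<omega> n = h n} \<in> sets M"
    by (rule sets.sets_Collect_finite_All) (use round in auto)
  then have "{\<omega> \<in> space M. (\<forall>n\<in>{..<N}. \<omega> n = h n) \<and> Q (\<omega> N)} \<in> sets M"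
    by (intro sets.sets_Collect_conj round)
  then show ?thesis by (simp only: lessThan_iff Ball_def)
qed

text \<open>If the prescribed probability after a history is 0 or 1, the runs that continue this history
  with the forbidden move have probability zero. Only finitely many histories have length \<open>N\<close>,
  so almost every run obeys the rule in that round. The maps \<open>own\<close> and \<open>other\<close> let the same
  argument serve both players.\<close>

lemma AE_move_determined:
  fixes own other :: "outcome \<Rightarrow> move" and q :: "(nat \<Rightarrow> outcome) \<Rightarrow> real"
  assumes law: "play_law M"
    and past: "\<And>h h'. (\<And>n. n < N \<Longrightarrow> h n = h' n) \<Longrightarrow> q h = q h'"
    and q01: "\<And>h. q h \<in> {0, 1}"
    and use: "\<And>h b. measure M {\<omega> \<in> space M. (\<forall>n<N. \<omega> n = h n) \<and> own (\<omega> N) = Coop \<and> other (\<omega> N) = b}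
      = q h * measure M {\<omega> \<in> space M. (\<forall>n<N. \<omega> n = h n) \<and> other (\<omega> N) = b}"
  shows "AE \<omega> in M. own (\<omega> N) = Coop \<longleftrightarrow> q \<omega> = 1"
proof -
  interpret prob_space M using law by (simp add: play_law_def)
  \<comment> \<open>A history is represented by its extensional restriction, so that there are finitely many.\<close>
  define H where "H = (\<Pi>\<^sub>E n\<in>{..<N}. (UNIV :: outcome set))"
  have "finite H"
    unfolding H_def by (intro finite_PiE) (auto simp: finite_outcome)
  define bad where "bad h b = {\<omega> \<in> space M. (\<forall>n<N. \<omega> n = h n) \<and>
      \<not> (own (\<omega> N) = Coop \<longleftrightarrow> q h = 1) \<and> other (\<omega> N) = b}" for h b
  have null: "AE \<omega> in M. \<omega> \<notin> bad h b" for h b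
  proof -
    let ?A = "{\<omega> \<in> space M. (\<forall>n<N. \<omega> n = h n) \<and> own (\<omega> N) = Coop \<and> other (\<omega> N) = b}"
    let ?B = "{\<omega> \<in> space M. (\<forall>n<N. \<omega> n = h n) \<and> other (\<omega> N) = b}"
    have A: "?A \<in> sets M"
      by (rule cylinder_in_sets[OF law, where Q = "\<lambda>z. own z = Coop \<and> other z = b"])
    have B: "?B \<in> sets M"
      by (rule cylinder_in_sets[OF law, where Q = "\<lambda>z. other z = b"])
    have bad: "bad h b \<in> sets M"
      unfolding bad_def
      by (rule cylinder_in_sets[OF law, where Q = "\<lambda>z. \<not> (own z = Coop \<longleftrightarrow> q h = 1) \<and> other z = b"])
    have "measure M (bad h b) = 0"
    proof (cases "q h = 1")
      case True
      have "bad h b = ?B - ?A" using True by (auto simp: bad_def)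
      moreover have "measure M (?B - ?A) = measure M ?B - measure M ?A"
        by (rule finite_measure_Diff[OF B A]) auto
      ultimately show ?thesis using use[of h b] True by simp
    next
      case False
      then have "bad h b = ?A" by (auto simp: bad_def)
      then show ?thesis using use[of h b] False q01[of h] by simp
    qed
    then show ?thesis
      using bad by (intro AE_not_in) (simp add: null_sets_def emeasure_eq_measure)
  qed
  have "AE \<omega> in M. \<forall>h\<in>H. \<forall>b\<in>UNIV. \<omega> \<notin> bad h b"
    using null by (simp only: AE_finite_all[OF \<open>finite H\<close>] AE_finite_all[OF finite_move]) simp
  then show ?thesis
  proof (rule AE_mp, intro AE_I2 impI)
    fix \<omega> assume \<omega>: "\<omega> \<in> space M" and good: "\<forall>h\<in>H. \<forall>b\<in>UNIV. \<omega> \<notin> bad h b"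
    have "restrict \<omega> {..<N} \<in> H" by (auto simp: H_def)
    then have "\<omega> \<notin> bad (restrict \<omega> {..<N}) (other (\<omega> N))" using good by blast
    moreover have "q (restrict \<omega> {..<N}) = q \<omega>" by (rule past) simp
    ultimately show "own (\<omega> N) = Coop \<longleftrightarrow> q \<omega> = 1"
      using \<omega> by (simp add: bad_def)
  qed
qed

lemma avg_payoff_past:
  "(\<And>n. n < N \<Longrightarrow> h n = h' n) \<Longrightarrow> avg_payoff R S T P h N = avg_payoff R S T P h' N"
  by (simp add: avg_payoff_def)

lemma AE_eventually_follows_X:
  assumes law: "play_law M" and ev: "eventually_plays_X R S T P M (cone_plan \<kappa> s)"
  shows "AE \<omega> in M. \<exists>N0. \<forall>N\<ge>N0. fst (\<omega> N) = Coop \<longleftrightarrow> guard \<kappa> (excess R S T P s \<omega> N) \<le> 0"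
proof -
  obtain N0 where "N0 \<ge> 1" and use: "\<And>N. N \<ge> N0 \<Longrightarrow> uses_X R S T P M (cone_plan \<kappa> s) N"
    using ev by (auto simp: eventually_plays_X_def)
  have "AE \<omega> in M. N \<ge> N0 \<longrightarrow> (fst (\<omega> N) = Coop \<longleftrightarrow> guard \<kappa> (excess R S T P s \<omega> N) \<le> 0)" for N
  proof (cases "N \<ge> N0")
    case True
    have "AE \<omega> in M. fst (\<omega> N) = Coop \<longleftrightarrow> cone_plan \<kappa> s (avg_payoff R S T P \<omega> N) = 1"
    proof (rule AE_move_determined[OF law, where other = snd])
      show "cone_plan \<kappa> s (avg_payoff R S T P h N) = cone_plan \<kappa> s (avg_payoff R S T P h' N)"
        if "\<And>n. n < N \<Longrightarrow> h n = h' n" for h h'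
        using avg_payoff_past[of N h h', OF that] by simp
      have "\<omega> N = (Coop, b) \<longleftrightarrow> fst (\<omega> N) = Coop \<and> snd (\<omega> N) = b" for \<omega> :: "nat \<Rightarrow> outcome" and b
        by (auto simp: prod_eq_iff)
      then show "measure M {\<omega> \<in> space M. (\<forall>n<N. \<omega> n = h n) \<and> fst (\<omega> N) = Coop \<and> snd (\<omega> N) = b}
        = cone_plan \<kappa> s (avg_payoff R S T P h N) *
          measure M {\<omega> \<in> space M. (\<forall>n<N. \<omega> n = h n) \<and> snd (\<omega> N) = b}" for h b
        using use[OF True] unfolding uses_X_def by simp
    qed (simp add: cone_plan_def)
    then show ?thesis
      using cone_plan_X_iff \<open>N0 \<ge> 1\<close> True by simp
  qed simp
  then have "AE \<omega> in M. \<forall>N. N \<ge> N0 \<longrightarrow> (fst (\<omega> N) = Coop \<longleftrightarrow> guard \<kappa> (excess R S T P s \<omega> N) \<le> 0)"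
    by (simp add: AE_all_countable)
  then show ?thesis by (rule AE_mp) (intro AE_I2, blast)
qed

lemma AE_eventually_follows_Y:
  assumes law: "play_law M" and ev: "eventually_plays_Y R S T P M (cone_plan \<kappa> (prod.swap s))"
  shows "AE \<omega> in M. \<exists>N0. \<forall>N\<ge>N0.
    snd (\<omega> N) = Coop \<longleftrightarrow> guard \<kappa> (prod.swap (excess R S T P s \<omega> N)) \<le> 0"
proof -
  let ?\<pi> = "cone_plan \<kappa> (prod.swap s)"
  obtain N0 where "N0 \<ge> 1" and use: "\<And>N. N \<ge> N0 \<Longrightarrow> uses_Y R S T P M ?\<pi> N"
    using ev by (auto simp: eventually_plays_Y_def)
  have "AE \<omega> in M. N \<ge> N0 \<longrightarrow>
      (snd (\<omega> N) = Coop \<longleftrightarrow> guard \<kappa> (prod.swap (excess R S T P s \<omega> N)) \<le> 0)" for N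
  proof (cases "N \<ge> N0")
    case True
    have "AE \<omega> in M. snd (\<omega> N) = Coop \<longleftrightarrow> ?\<pi> (prod.swap (avg_payoff R S T P \<omega> N)) = 1"
    proof (rule AE_move_determined[OF law, where other = fst])
      show "?\<pi> (prod.swap (avg_payoff R S T P h N)) = ?\<pi> (prod.swap (avg_payoff R S T P h' N))"
        if "\<And>n. n < N \<Longrightarrow> h n = h' n" for h h'
        using avg_payoff_past[of N h h', OF that] by simp
      have "\<omega> N = (a, Coop) \<longleftrightarrow> snd (\<omega> N) = Coop \<and> fst (\<omega> N) = a" for \<omega> :: "nat \<Rightarrow> outcome" and a
        by (auto simp: prod_eq_iff)
      then show "measure M {\<omega> \<in> space M. (\<forall>n<N. \<omega> n = h n) \<and> snd (\<omega> N) = Coop \<and> fst (\<omega> N) = a}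
        = ?\<pi> (prod.swap (avg_payoff R S T P h N)) *
          measure M {\<omega> \<in> space M. (\<forall>n<N. \<omega> n = h n) \<and> fst (\<omega> N) = a}" for h a
        using use[OF True] unfolding uses_Y_def by simp
    qed (simp add: cone_plan_def)
    then show ?thesis
      using cone_plan_Y_iff \<open>N0 \<ge> 1\<close> True by simp
  qed simp
  then have "AE \<omega> in M. \<forall>N. N \<ge> N0 \<longrightarrow>
      (snd (\<omega> N) = Coop \<longleftrightarrow> guard \<kappa> (prod.swap (excess R S T P s \<omega> N)) \<le> 0)"
    by (simp add: AE_all_countable)
  then show ?thesis by (rule AE_mp) (intro AE_I2, blast)
qed

section \<open>Boundedness of the guard and limit points\<close>

text \<open>A quantity with bounded steps that never increases while it is large has this form: \<open>C\<close> is the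
  threshold plus the largest step.\<close>

lemma bounded_above_of_step:
  fixes F :: "nat \<Rightarrow> real"
  assumes "\<And>n. n \<ge> N0 \<Longrightarrow> F (Suc n) \<le> max (F n) C" and "n \<ge> N0"
  shows "F n \<le> max (F N0) C"
  using assms(2)
proof (induction n rule: dec_induct)
  case (step n)
  then show ?case using assms(1)[of n] by linarith
qed simp

text \<open>While the guard of the sum is positive, the next step has guard at most 0 and subadditivity keeps
  the guard of the sum from growing; otherwise one step raises it to at most \<open>C\<close>.\<close>

lemma guard_sum_bounded_above:
  fixes w :: "nat \<Rightarrow> real \<times> real"
  assumes "0 \<le> \<kappa>" and bound: "\<And>n. guard \<kappa> (w n) \<le> C"
    and drift: "\<And>n. n \<ge> N0 \<Longrightarrow> guard \<kappa> (\<Sum>k<n. w k) > 0 \<Longrightarrow> guard \<kappa> (w n) \<le> 0"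
  shows "\<exists>B. \<forall>n\<ge>N0. guard \<kappa> (\<Sum>k<n. w k) \<le> B"
proof -
  let ?F = "\<lambda>n. guard \<kappa> (\<Sum>k<n. w k)"
  have "?F (Suc n) \<le> max (?F n) C" if "n \<ge> N0" for n
    using guard_add_le[OF \<open>0 \<le> \<kappa>\<close>, of "\<Sum>k<n. w k" "w n"] bound[of n] drift[OF that]
    by (cases "?F n > 0") auto
  then show ?thesis
    using bounded_above_of_step[of N0 ?F C] by blast
qed

lemma seq_limit_point_continuous_image:
  assumes "seq_limit_point x V" and "isCont f V"
  shows "seq_limit_point (\<lambda>n. f (x n)) (f V)"
proof -
  obtain r where r: "strict_mono r" and xr: "(x \<circ> r) \<longlonglongrightarrow> V"
    using assms(1) by (auto simp: seq_limit_point_def)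
  have "(\<lambda>n. f ((x \<circ> r) n)) \<longlonglongrightarrow> f V"
    by (rule isCont_tendsto_compose[OF assms(2) xr])
  then have "((\<lambda>n. f (x n)) \<circ> r) \<longlonglongrightarrow> f V" by (simp add: comp_def)
  with r show ?thesis unfolding seq_limit_point_def by blast
qed

text \<open>Homogeneity of the guard turns a constant bound for \<open>N x\<^sub>N\<close> into the bound \<open>B / N\<close> for
  \<open>x\<^sub>N\<close>, and continuity passes it to the limit.\<close>

lemma guard_limit_point_le_0:
  assumes bound: "\<And>N. N \<ge> N0 \<Longrightarrow> guard \<kappa> (real N *\<^sub>R x N) \<le> B"
    and lim: "seq_limit_point x V"
  shows "guard \<kappa> V \<le> 0"
proof -
  obtain r where r: "strict_mono r" and xr: "(x \<circ> r) \<longlonglongrightarrow> V"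
    using lim by (auto simp: seq_limit_point_def)
  have "(\<lambda>n. guard \<kappa> ((x \<circ> r) n)) \<longlonglongrightarrow> guard \<kappa> V"
    unfolding guard_def by (intro tendsto_intros xr)
  moreover have "(\<lambda>n. B / real (r n)) \<longlonglongrightarrow> 0"
    by (intro tendsto_divide_0[OF tendsto_const] filterlim_at_top_imp_at_infinity
        filterlim_compose[OF filterlim_real_sequentially] filterlim_subseq r)
  moreover have "guard \<kappa> ((x \<circ> r) n) \<le> B / real (r n)" if "n \<ge> Suc N0" for n
  proof -
    have "r n \<ge> n" using r by (rule seq_suble)
    then have "r n \<ge> N0" "r n > 0" using that by auto
    then show ?thesis
      using bound[of "r n"] by (simp add: guard_scaleR field_simps)
  qed
  ultimately show ?thesis
    by (intro tendsto_le[OF sequentially_bot, of "\<lambda>n. B / real (r n)" 0])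
      (auto simp: eventually_sequentially)
qed

section \<open>A walk steered by both cones is bounded\<close>

text \<open>In this section \<open>(x, y)\<close> is the current excess and \<open>(a, b)\<close> the next step. The
  functionals \<open>\<alpha> x + \<beta> y\<close> and \<open>\<beta> x + \<alpha> y\<close>, with \<open>\<alpha> = R - S\<close> and
  \<open>\<beta> = T - R\<close> in the application, are the outward normals of the two edges of the payoff region
  at \<open>(R, R)\<close>. The condition \<open>\<beta> < \<alpha>\<close> is \<open>2 * R > T + S\<close>; it decides which of the two
  is the smaller one on each side of the diagonal.\<close>

lemma support_le_other_support:
  fixes \<alpha> \<beta> x y :: real
  assumes "\<beta> < \<alpha>" and "x \<le> y"
  shows "\<alpha> * x + \<beta> * y \<le> \<beta> * x + \<alpha> * y"
proof -
  have "0 \<le> (\<alpha> - \<beta>) * (y - x)" using assms by simp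
  then show ?thesis by (simp add: algebra_simps)
qed

text \<open>Well above the diagonal the smaller functional is the one that Y's cooperation protects. The
  distance \<open>2 * B\<close> puts the excess inside Y's cone, because \<open>y \<le> B\<close> and the cone has slope
  less than 1; the distance \<open>2 * c\<close> keeps the walk on the same side of the diagonal after the
  step, so that the minimum is still attained by the same functional.\<close>

lemma min_support_step_off_diagonal:
  fixes \<alpha> \<beta> \<kappa> B c :: real
  assumes \<alpha>\<beta>: "\<beta> < \<alpha>" and \<kappa>: "0 < \<kappa>" "\<kappa> < 1"
    and B: "y + \<kappa> * \<bar>x\<bar> \<le> B" "x + \<kappa> * \<bar>y\<bar> \<le> B" "0 \<le> B" and c: "\<bar>a\<bar> \<le> c" "\<bar>b\<bar> \<le> c"
    and coop: "x + \<kappa> * \<bar>y\<bar> \<le> 0 \<Longrightarrow> 0 \<le> \<alpha> * a + \<beta> * b"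
    and far: "x \<le> y - (2 * B + 2 * c)"
  shows "min (\<alpha> * x + \<beta> * y) (\<beta> * x + \<alpha> * y)
    \<le> min (\<alpha> * (x + a) + \<beta> * (y + b)) (\<beta> * (x + a) + \<alpha> * (y + b))"
proof -
  have "0 \<le> c" using c by linarith
  have "y \<le> B" using B(1) \<kappa> mult_nonneg_nonneg[of \<kappa> "\<bar>x\<bar>"] by linarith
  have "x + \<kappa> * \<bar>y\<bar> \<le> 0"
  proof (cases "y \<ge> 0")
    case True
    have "\<kappa> * \<bar>y\<bar> \<le> 1 * B"
      by (rule mult_mono) (use True \<open>y \<le> B\<close> \<kappa> B(3) in auto)
    then show ?thesis using far \<open>y \<le> B\<close> \<open>0 \<le> c\<close> by linarith
  next
    case False
    have "\<kappa> * \<bar>y\<bar> \<le> 1 * \<bar>y\<bar>"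
      by (rule mult_right_mono) (use \<kappa> in auto)
    then show ?thesis using far False \<open>0 \<le> c\<close> B(3) by linarith
  qed
  then have "0 \<le> \<alpha> * a + \<beta> * b" by (rule coop)
  then have "\<alpha> * x + \<beta> * y \<le> \<alpha> * (x + a) + \<beta> * (y + b)" by (simp add: algebra_simps)
  moreover have "x + a \<le> y + b" using far c B(3) by linarith
  then have "\<alpha> * (x + a) + \<beta> * (y + b) \<le> \<beta> * (x + a) + \<alpha> * (y + b)"
    using \<alpha>\<beta> support_le_other_support by blast
  ultimately show ?thesis by linarith
qed

lemma coordinates_negative_near_diagonal:
  fixes \<alpha> \<beta> K Q :: real
  assumes pos: "0 < \<beta>" "0 < \<alpha>" and near: "\<bar>x - y\<bar> \<le> K"
    and low: "\<alpha> * x + \<beta> * y < - ((\<alpha> + \<beta>) * (Q + K))"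
  shows "x < - Q" and "y < - Q"
proof -
  have "(\<alpha> + \<beta>) * min x y \<le> \<alpha> * x + \<beta> * y"
    using pos unfolding distrib_right by (intro add_mono mult_left_mono) auto
  then have "(\<alpha> + \<beta>) * min x y < (\<alpha> + \<beta>) * (- Q - K)" using low by (simp add: algebra_simps)
  then have "min x y < - Q - K" using pos by (simp add: mult_less_cancel_left_pos)
  then show "x < - Q" "y < - Q" using near by linarith+
qed

text \<open>The negative half of the diagonal lies in the interior of the cone since \<open>\<kappa> < 1\<close>. Below
  \<open>- Q = - K / (1 - \<kappa>)\<close> the cone is wide enough to contain the strip
  \<open>\<bar>x - y\<bar> \<le> K\<close>.\<close>

lemma guard_le_0_near_diagonal:
  fixes \<kappa> K Q :: real
  assumes \<kappa>: "0 < \<kappa>" "\<kappa> < 1" and "0 \<le> K" and Q: "(1 - \<kappa>) * Q = K"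
    and "\<bar>x - y\<bar> \<le> K" and "x < - Q"
  shows "x + \<kappa> * \<bar>y\<bar> \<le> 0"
proof -
  have "0 \<le> Q" using Q \<kappa> \<open>0 \<le> K\<close> by (smt (verit) mult_pos_neg)
  have "\<kappa> * \<bar>y\<bar> \<le> \<kappa> * (\<bar>x\<bar> + K)" using assms by (intro mult_left_mono) auto
  moreover have "\<kappa> * K \<le> K" using \<kappa> \<open>0 \<le> K\<close> mult_right_mono[of \<kappa> 1 K] by simp
  moreover have "(1 - \<kappa>) * Q \<le> (1 - \<kappa>) * - x" using \<kappa> \<open>x < - Q\<close> by (intro mult_left_mono) auto
  moreover have "\<bar>x\<bar> = - x" using \<open>x < - Q\<close> \<open>0 \<le> Q\<close> by linarith
  ultimately show ?thesis using Q by (simp add: algebra_simps)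
qed

text \<open>The potential does not decrease where it is very negative: off the diagonal one player protects
  the smaller functional, and in the strip around the diagonal a low potential forces the excess
  deep into the negative quadrant, where both players cooperate.\<close>

lemma min_support_step:
  fixes \<alpha> \<beta> \<kappa> B c :: real
  assumes \<alpha>\<beta>: "0 < \<beta>" "\<beta> < \<alpha>" and \<kappa>: "0 < \<kappa>" "\<kappa> < 1"
    and B: "y + \<kappa> * \<bar>x\<bar> \<le> B" "x + \<kappa> * \<bar>y\<bar> \<le> B" "0 \<le> B" and c: "\<bar>a\<bar> \<le> c" "\<bar>b\<bar> \<le> c"
    and coop_X: "y + \<kappa> * \<bar>x\<bar> \<le> 0 \<Longrightarrow> 0 \<le> \<beta> * a + \<alpha> * b"
    and coop_Y: "x + \<kappa> * \<bar>y\<bar> \<le> 0 \<Longrightarrow> 0 \<le> \<alpha> * a + \<beta> * b"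
    and K: "K = 2 * B + 2 * c" and Q: "(1 - \<kappa>) * Q = K"
    and low: "min (\<alpha> * x + \<beta> * y) (\<beta> * x + \<alpha> * y) < - ((\<alpha> + \<beta>) * (Q + K))"
  shows "min (\<alpha> * x + \<beta> * y) (\<beta> * x + \<alpha> * y)
    \<le> min (\<alpha> * (x + a) + \<beta> * (y + b)) (\<beta> * (x + a) + \<alpha> * (y + b))"
proof -
  have "0 < \<alpha>" using \<alpha>\<beta> by linarith
  have "0 \<le> K" using c B(3) K by linarith
  consider "x \<le> y - K" | "y \<le> x - K" | "\<bar>x - y\<bar> \<le> K" by linarith
  then show ?thesis
  proof cases
    case 1
    then show ?thesis
      using min_support_step_off_diagonal[OF \<alpha>\<beta>(2) \<kappa> B c coop_Y] K by blast
  next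
    case 2
    have "0 \<le> \<alpha> * b + \<beta> * a" if "y + \<kappa> * \<bar>x\<bar> \<le> 0" using coop_X[OF that] by simp
    from min_support_step_off_diagonal[OF \<alpha>\<beta>(2) \<kappa> B(2,1,3) c(2,1) this] 2 K
    show ?thesis by (simp add: add.commute min.commute)
  next
    case 3
    have "\<bar>y - x\<bar> \<le> K" using 3 by linarith
    have "x < - Q \<and> y < - Q"
    proof (cases "\<alpha> * x + \<beta> * y < - ((\<alpha> + \<beta>) * (Q + K))")
      case True
      then show ?thesis
        using coordinates_negative_near_diagonal[OF \<alpha>\<beta>(1) \<open>0 < \<alpha>\<close> 3] by blast
    next
      case False
      then have "\<alpha> * y + \<beta> * x < - ((\<alpha> + \<beta>) * (Q + K))" using low by linarith
      then show ?thesis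
        using coordinates_negative_near_diagonal[OF \<alpha>\<beta>(1) \<open>0 < \<alpha>\<close> \<open>\<bar>y - x\<bar> \<le> K\<close>] by blast
    qed
    then have "x + \<kappa> * \<bar>y\<bar> \<le> 0" "y + \<kappa> * \<bar>x\<bar> \<le> 0"
      using guard_le_0_near_diagonal[OF \<kappa> \<open>0 \<le> K\<close> Q] 3 \<open>\<bar>y - x\<bar> \<le> K\<close> by blast+
    from coop_Y[OF this(1)] coop_X[OF this(2)]
    show ?thesis unfolding distrib_left by linarith
  qed
qed

text \<open>The guards bound both coordinates above, the potential is bounded below, and since both
  functionals have positive coefficients this bounds the coordinates below as well.\<close>

lemma total_bounded_of_guards:
  fixes x y a b :: "nat \<Rightarrow> real"
  assumes step: "\<And>n. x (Suc n) = x n + a n" "\<And>n. y (Suc n) = y n + b n"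
    and \<alpha>\<beta>: "0 < \<beta>" "\<beta> < \<alpha>" and \<kappa>: "0 < \<kappa>" "\<kappa> < 1" and c: "\<And>n. \<bar>a n\<bar> \<le> c" "\<And>n. \<bar>b n\<bar> \<le> c"
    and B: "\<And>n. n \<ge> N0 \<Longrightarrow> y n + \<kappa> * \<bar>x n\<bar> \<le> B" "\<And>n. n \<ge> N0 \<Longrightarrow> x n + \<kappa> * \<bar>y n\<bar> \<le> B" "0 \<le> B"
    and coop_X: "\<And>n. n \<ge> N0 \<Longrightarrow> y n + \<kappa> * \<bar>x n\<bar> \<le> 0 \<Longrightarrow> 0 \<le> \<beta> * a n + \<alpha> * b n"
    and coop_Y: "\<And>n. n \<ge> N0 \<Longrightarrow> x n + \<kappa> * \<bar>y n\<bar> \<le> 0 \<Longrightarrow> 0 \<le> \<alpha> * a n + \<beta> * b n"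
  shows "\<exists>D. \<forall>n\<ge>N0. \<bar>x n\<bar> \<le> D \<and> \<bar>y n\<bar> \<le> D"
proof -
  define K where "K = 2 * B + 2 * c"
  define Q where "Q = K / (1 - \<kappa>)"
  define L where "L = (\<alpha> + \<beta>) * (Q + K)"
  let ?m = "\<lambda>n. min (\<alpha> * x n + \<beta> * y n) (\<beta> * x n + \<alpha> * y n)"
  have Q: "(1 - \<kappa>) * Q = K" using \<kappa> by (simp add: Q_def)
  have m_step: "- ?m (Suc n) \<le> max (- ?m n) (L + (\<alpha> + \<beta>) * c)" if "n \<ge> N0" for n
  proof (cases "?m n < - L")
    case True
    have "?m n \<le> ?m (Suc n)"
      using min_support_step[OF \<alpha>\<beta> \<kappa> B(1,2)[OF that] B(3) c coop_X[OF that] coop_Y[OF that] K_def Q]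
        True unfolding step L_def by blast
    then show ?thesis by linarith
  next
    case False
    have "\<bar>\<alpha> * a n\<bar> \<le> \<alpha> * c" "\<bar>\<beta> * a n\<bar> \<le> \<beta> * c" "\<bar>\<alpha> * b n\<bar> \<le> \<alpha> * c" "\<bar>\<beta> * b n\<bar> \<le> \<beta> * c"
      using \<alpha>\<beta> c by (auto simp: abs_mult)
    then have "\<alpha> * x n + \<beta> * y n - (\<alpha> + \<beta>) * c \<le> \<alpha> * x (Suc n) + \<beta> * y (Suc n)"
      "\<beta> * x n + \<alpha> * y n - (\<alpha> + \<beta>) * c \<le> \<beta> * x (Suc n) + \<alpha> * y (Suc n)"
      unfolding step distrib_left distrib_right by linarith+
    then have "?m n - (\<alpha> + \<beta>) * c \<le> ?m (Suc n)" by linarith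
    then show ?thesis using False by linarith
  qed
  define E where "E = max (- ?m N0) (L + (\<alpha> + \<beta>) * c)"
  have m: "- ?m n \<le> E" if "n \<ge> N0" for n
    unfolding E_def using bounded_above_of_step[of N0 "\<lambda>n. - ?m n", OF m_step that] .
  have "\<bar>x n\<bar> \<le> max B ((E + \<beta> * B) / \<alpha>) \<and> \<bar>y n\<bar> \<le> max B ((E + \<beta> * B) / \<alpha>)" if "n \<ge> N0" for n
  proof -
    have le_B: "x n \<le> B" "y n \<le> B"
      using B(1,2)[OF that] \<kappa> mult_nonneg_nonneg[of \<kappa> "\<bar>x n\<bar>"] mult_nonneg_nonneg[of \<kappa> "\<bar>y n\<bar>"]
      by linarith+
    then have "\<beta> * x n \<le> \<beta> * B" "\<beta> * y n \<le> \<beta> * B" using \<alpha>\<beta> by auto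
    then have "- (\<alpha> * x n) \<le> E + \<beta> * B" "- (\<alpha> * y n) \<le> E + \<beta> * B"
      using m[OF that] by linarith+
    then have "- x n \<le> (E + \<beta> * B) / \<alpha>" "- y n \<le> (E + \<beta> * B) / \<alpha>"
      using \<alpha>\<beta> by (simp_all add: pos_le_divide_eq mult.commute)
    then show ?thesis using le_B by linarith
  qed
  then show ?thesis by blast
qed

section \<open>The equilibrium\<close>

lemma payoff_region_le:
  assumes "s \<in> payoff_region R S T P"
    and "R * p + R * q \<le> m" "S * p + T * q \<le> m" "T * p + S * q \<le> m" "P * p + P * q \<le> m"
  shows "fst s * p + snd s * q \<le> m"
proof -
  have "convex {v :: real \<times> real. inner (p, q) v \<le> m}" by (rule convex_halfspace_le)
  moreover have "{(R, R), (S, T), (T, S), (P, P)} \<subseteq> {v. inner (p, q) v \<le> m}"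
    using assms by (auto simp: mult.commute)
  ultimately have "payoff_region R S T P \<subseteq> {v. inner (p, q) v \<le> m}"
    unfolding payoff_region_def by (rule hull_minimal[rotated])
  then show ?thesis using assms(1) by (auto simp: inner_prod_def mult.commute)
qed

text \<open>As \<open>\<kappa>\<close> tends to 0, the guard tends to the second coordinate.\<close>

lemma small_slope_exists:
  fixes A :: "(real \<times> real) set"
  assumes "finite A" and "\<And>v. v \<in> A \<Longrightarrow> snd v < 0"
  shows "\<exists>\<kappa>. 0 < \<kappa> \<and> \<kappa> < 1 \<and> (\<forall>v\<in>A. guard \<kappa> v \<le> 0)"
proof -
  have "eventually (\<lambda>\<kappa>. guard \<kappa> v < 0) (at_right 0)" if "v \<in> A" for v
  proof (rule order_tendstoD(2))
    show "((\<lambda>\<kappa>. guard \<kappa> v) \<longlongrightarrow> snd v + 0 * \<bar>fst v\<bar>) (at_right 0)"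
      unfolding guard_def by (intro tendsto_intros)
    show "snd v + 0 * \<bar>fst v\<bar> < 0" using assms(2)[OF that] by simp
  qed
  then have "eventually (\<lambda>\<kappa>. \<forall>v\<in>A. guard \<kappa> v < 0) (at_right 0)"
    using \<open>finite A\<close> by (simp add: eventually_ball_finite_distrib)
  moreover have "eventually (\<lambda>\<kappa>::real. 0 < \<kappa> \<and> \<kappa> < 1) (at_right 0)"
    unfolding eventually_at_right_field by (intro exI[of _ 1]) auto
  ultimately have "eventually (\<lambda>\<kappa>. 0 < \<kappa> \<and> \<kappa> < 1 \<and> (\<forall>v\<in>A. guard \<kappa> v < 0)) (at_right 0)"
    by eventually_elim auto
  then have "\<exists>\<kappa>. 0 < \<kappa> \<and> \<kappa> < 1 \<and> (\<forall>v\<in>A. guard \<kappa> v < 0)"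
    by (rule eventually_happens'[rotated]) simp
  then show ?thesis by (meson less_imp_le)
qed

text \<open>What the argument needs of the target \<open>s\<close> and the slope \<open>\<kappa>\<close>: a step in which a player
  defects lies in that player's cone, and \<open>s\<close> lies on the inner side of the lines through
  \<open>(R, R)\<close>, \<open>(T, S)\<close> and through \<open>(R, R)\<close>, \<open>(S, T)\<close>; on both lines the normal
  functional has the value \<open>(T - S) * R\<close>.\<close>

locale guarded_target =
  fixes R S T P \<kappa> :: real and s :: "real \<times> real"
  assumes payoffs: "T > R" "R > P" "P > S" "2 * R > T + S"
    and slope: "0 < \<kappa>" "\<kappa> < 1"
    and guard_X_defects: "\<And>b. guard \<kappa> (payoff R S T P (Defect, b) - s) \<le> 0"
    and guard_Y_defects: "\<And>a. guard \<kappa> (prod.swap (payoff R S T P (a, Defect) - s)) \<le> 0"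
    and supports: "fst s * (R - S) + snd s * (T - R) \<le> (T - S) * R"
      "fst s * (T - R) + snd s * (R - S) \<le> (T - S) * R"
begin

abbreviation gain :: "(nat \<Rightarrow> outcome) \<Rightarrow> nat \<Rightarrow> real \<times> real" where
  "gain \<omega> n \<equiv> payoff R S T P (\<omega> n) - s"

abbreviation total :: "(nat \<Rightarrow> outcome) \<Rightarrow> nat \<Rightarrow> real \<times> real" where
  "total \<equiv> excess R S T P s"

lemma gain_bounded: "\<exists>c. \<forall>z. \<bar>fst (payoff R S T P z - s)\<bar> \<le> c \<and> \<bar>snd (payoff R S T P z - s)\<bar> \<le> c"
proof -
  let ?A = "range (\<lambda>z. max \<bar>fst (payoff R S T P z - s)\<bar> \<bar>snd (payoff R S T P z - s)\<bar>)"
  have "finite ?A" using finite_outcome by simp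
  then have "max \<bar>fst (payoff R S T P z - s)\<bar> \<bar>snd (payoff R S T P z - s)\<bar> \<le> Max ?A" for z
    by (intro Max_ge) auto
  then show ?thesis by (intro exI[of _ "Max ?A"]) auto
qed

lemma guard_total_X_bounded:
  assumes "\<And>N. N \<ge> N0 \<Longrightarrow> fst (\<omega> N) = Coop \<longleftrightarrow> guard \<kappa> (total \<omega> N) \<le> 0"
  shows "\<exists>B. \<forall>N\<ge>N0. guard \<kappa> (total \<omega> N) \<le> B"
proof -
  obtain c where c: "\<And>z. \<bar>fst (payoff R S T P z - s)\<bar> \<le> c" "\<And>z. \<bar>snd (payoff R S T P z - s)\<bar> \<le> c"
    using gain_bounded by blast
  have "guard \<kappa> (gain \<omega> n) \<le> c + \<kappa> * c" for n
    using c(2)[of "\<omega> n"] mult_left_mono[OF c(1)[of "\<omega> n"], of \<kappa>] slope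
    unfolding guard_def by linarith
  moreover have "guard \<kappa> (gain \<omega> n) \<le> 0" if "n \<ge> N0" "guard \<kappa> (total \<omega> n) > 0" for n
  proof -
    have "fst (\<omega> n) = Defect" using assms that move.exhaust not_less by metis
    then show ?thesis using guard_X_defects[of "snd (\<omega> n)"] by (metis prod.collapse)
  qed
  ultimately show ?thesis
    using guard_sum_bounded_above[of \<kappa> "gain \<omega>" "c + \<kappa> * c" N0] slope by (simp add: excess_def)
qed

lemma swap_total: "prod.swap (total \<omega> N) = (\<Sum>n<N. prod.swap (gain \<omega> n))"
  by (simp add: excess_def prod_eq_iff fst_sum snd_sum)

lemma guard_total_Y_bounded:
  assumes "\<And>N. N \<ge> N0 \<Longrightarrow> snd (\<omega> N) = Coop \<longleftrightarrow> guard \<kappa> (prod.swap (total \<omega> N)) \<le> 0"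
  shows "\<exists>B. \<forall>N\<ge>N0. guard \<kappa> (prod.swap (total \<omega> N)) \<le> B"
proof -
  obtain c where c: "\<And>z. \<bar>fst (payoff R S T P z - s)\<bar> \<le> c" "\<And>z. \<bar>snd (payoff R S T P z - s)\<bar> \<le> c"
    using gain_bounded by blast
  have "guard \<kappa> (prod.swap (gain \<omega> n)) \<le> c + \<kappa> * c" for n
    using c(1)[of "\<omega> n"] mult_left_mono[OF c(2)[of "\<omega> n"], of \<kappa>] slope
    unfolding guard_def fst_swap snd_swap by linarith
  moreover have "guard \<kappa> (prod.swap (gain \<omega> n)) \<le> 0"
    if "n \<ge> N0" "guard \<kappa> (prod.swap (total \<omega> n)) > 0" for n
  proof -
    have "snd (\<omega> n) = Defect" using assms that move.exhaust not_less by metis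
    then show ?thesis using guard_Y_defects[of "fst (\<omega> n)"] by (metis prod.collapse)
  qed
  ultimately show ?thesis
    using guard_sum_bounded_above[of \<kappa> "\<lambda>n. prod.swap (gain \<omega> n)" "c + \<kappa> * c" N0] slope
    by (simp add: swap_total)
qed

lemma scaled_average: "N \<ge> 1 \<Longrightarrow> real N *\<^sub>R (avg_payoff R S T P \<omega> N - s) = total \<omega> N"
  by (simp add: avg_payoff_minus_target)

lemma eq_target_of_guard:
  assumes "guard \<kappa> v \<le> 0" and "0 \<le> snd v"
  shows "v = 0"
proof -
  have "0 \<le> \<kappa> * \<bar>fst v\<bar>" using slope by simp
  then have "snd v = 0" "\<kappa> * \<bar>fst v\<bar> = 0" using assms unfolding guard_def by linarith+
  then show ?thesis using slope by (simp add: prod_eq_iff)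
qed

text \<open>Against any play of Y, the bounded guard puts every limit point into X's cone, and the cone meets
  the half-plane where Y gets at least the target only at its apex.\<close>

lemma X_plan_punishes:
  assumes "\<And>N. N \<ge> N0 \<Longrightarrow> fst (\<omega> N) = Coop \<longleftrightarrow> guard \<kappa> (total \<omega> N) \<le> 0"
    and "seq_limit_point (avg_payoff R S T P \<omega>) V" and "snd s \<le> snd V"
  shows "V = s"
proof -
  obtain B where B: "\<And>N. N \<ge> N0 \<Longrightarrow> guard \<kappa> (total \<omega> N) \<le> B"
    using guard_total_X_bounded[OF assms(1)] by blast
  have lim: "seq_limit_point (\<lambda>N. avg_payoff R S T P \<omega> N - s) (V - s)"
    using assms(2) by (rule seq_limit_point_continuous_image) (intro continuous_intros)
  have "guard \<kappa> (real N *\<^sub>R (avg_payoff R S T P \<omega> N - s)) \<le> B" if "N \<ge> max 1 N0" for N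
    using that B by (simp add: scaled_average)
  then have "guard \<kappa> (V - s) \<le> 0"
    using guard_limit_point_le_0[OF _ lim] by blast
  then show ?thesis using eq_target_of_guard[of "V - s"] assms(3) by simp
qed

lemma Y_plan_punishes:
  assumes "\<And>N. N \<ge> N0 \<Longrightarrow> snd (\<omega> N) = Coop \<longleftrightarrow> guard \<kappa> (prod.swap (total \<omega> N)) \<le> 0"
    and lim: "seq_limit_point (avg_payoff R S T P \<omega>) V" and "fst s \<le> fst V"
  shows "V = s"
proof -
  obtain B where B: "\<And>N. N \<ge> N0 \<Longrightarrow> guard \<kappa> (prod.swap (total \<omega> N)) \<le> B"
    using guard_total_Y_bounded[OF assms(1)] by blast
  have scaled: "real N *\<^sub>R prod.swap (avg_payoff R S T P \<omega> N - s) = prod.swap (total \<omega> N)"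
    if "N \<ge> 1" for N
    unfolding scaled_average[OF that, symmetric] by (simp add: prod_eq_iff)
  have "guard \<kappa> (real N *\<^sub>R prod.swap (avg_payoff R S T P \<omega> N - s)) \<le> B"
    if "N \<ge> max 1 N0" for N
    using that by (simp add: scaled B)
  moreover have "seq_limit_point (\<lambda>N. prod.swap (avg_payoff R S T P \<omega> N - s)) (prod.swap (V - s))"
    using lim unfolding prod.swap_def
    by (rule seq_limit_point_continuous_image) (intro continuous_intros)
  ultimately have "guard \<kappa> (prod.swap (V - s)) \<le> 0"
    by (rule guard_limit_point_le_0)
  then show ?thesis
    using eq_target_of_guard[of "prod.swap (V - s)"] assms(3) by (simp add: prod_eq_iff)
qed

text \<open>When X cooperates the outcome lies on the line through \<open>(R, R)\<close> and \<open>(S, T)\<close>, and \<open>s\<close>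
  is on its inner side.\<close>

lemma support_gain_X_cooperates:
  assumes "fst z = Coop"
  shows "0 \<le> (T - R) * fst (payoff R S T P z - s) + (R - S) * snd (payoff R S T P z - s)"
  using assms supports(2) by (cases z; cases "snd z") (auto simp: algebra_simps)

lemma support_gain_Y_cooperates:
  assumes "snd z = Coop"
  shows "0 \<le> (R - S) * fst (payoff R S T P z - s) + (T - R) * snd (payoff R S T P z - s)"
  using assms supports(1) by (cases z; cases "fst z") (auto simp: algebra_simps)

lemma both_plans_converge:
  assumes X: "\<And>N. N \<ge> N0 \<Longrightarrow> fst (\<omega> N) = Coop \<longleftrightarrow> guard \<kappa> (total \<omega> N) \<le> 0"
    and Y: "\<And>N. N \<ge> N0 \<Longrightarrow> snd (\<omega> N) = Coop \<longleftrightarrow> guard \<kappa> (prod.swap (total \<omega> N)) \<le> 0"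
  shows "avg_payoff R S T P \<omega> \<longlonglongrightarrow> s"
proof -
  obtain c where c: "\<And>z. \<bar>fst (payoff R S T P z - s)\<bar> \<le> c" "\<And>z. \<bar>snd (payoff R S T P z - s)\<bar> \<le> c"
    using gain_bounded by blast
  obtain B1 where B1: "\<And>N. N \<ge> N0 \<Longrightarrow> guard \<kappa> (total \<omega> N) \<le> B1"
    using guard_total_X_bounded[OF X] by blast
  obtain B2 where B2: "\<And>N. N \<ge> N0 \<Longrightarrow> guard \<kappa> (prod.swap (total \<omega> N)) \<le> B2"
    using guard_total_Y_bounded[OF Y] by blast
  define B where "B = max 0 (max B1 B2)"
  have "\<exists>D. \<forall>n\<ge>N0. \<bar>fst (total \<omega> n)\<bar> \<le> D \<and> \<bar>snd (total \<omega> n)\<bar> \<le> D"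
  proof (rule total_bounded_of_guards[where a = "\<lambda>n. fst (gain \<omega> n)" and b = "\<lambda>n. snd (gain \<omega> n)"
        and \<alpha> = "R - S" and \<beta> = "T - R" and B = B])
    show "snd (total \<omega> n) + \<kappa> * \<bar>fst (total \<omega> n)\<bar> \<le> B" if "n \<ge> N0" for n
      using B1[OF that] by (simp add: guard_def B_def)
    show "fst (total \<omega> n) + \<kappa> * \<bar>snd (total \<omega> n)\<bar> \<le> B" if "n \<ge> N0" for n
      using B2[OF that] by (simp add: guard_def B_def)
    show "0 \<le> (T - R) * fst (gain \<omega> n) + (R - S) * snd (gain \<omega> n)"
      if "n \<ge> N0" "snd (total \<omega> n) + \<kappa> * \<bar>fst (total \<omega> n)\<bar> \<le> 0" for n
      by (rule support_gain_X_cooperates) (use X that in \<open>simp add: guard_def\<close>)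
    show "0 \<le> (R - S) * fst (gain \<omega> n) + (T - R) * snd (gain \<omega> n)"
      if "n \<ge> N0" "fst (total \<omega> n) + \<kappa> * \<bar>snd (total \<omega> n)\<bar> \<le> 0" for n
      by (rule support_gain_Y_cooperates) (use Y that in \<open>simp add: guard_def\<close>)
    show "\<bar>fst (gain \<omega> n)\<bar> \<le> c" "\<bar>snd (gain \<omega> n)\<bar> \<le> c" for n
      by (rule c)+
  qed (use payoffs slope in \<open>simp_all add: excess_def B_def\<close>)
  then obtain D where D: "\<And>n. n \<ge> N0 \<Longrightarrow> \<bar>fst (total \<omega> n)\<bar> \<le> D \<and> \<bar>snd (total \<omega> n)\<bar> \<le> D"
    by blast
  have "(\<lambda>N. avg_payoff R S T P \<omega> N - s) \<longlonglongrightarrow> 0"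
  proof (rule Lim_null_comparison)
    have "norm (avg_payoff R S T P \<omega> N - s) \<le> (D + D) / real N" if "N \<ge> max 1 N0" for N
    proof -
      have "norm (total \<omega> N) \<le> D + D"
        using norm_Pair_le[of "fst (total \<omega> N)" "snd (total \<omega> N)"] D[of N] that by simp
      then show ?thesis
        using that by (simp add: avg_payoff_minus_target divide_right_mono)
    qed
    then show "\<forall>\<^sub>F N in sequentially. norm (avg_payoff R S T P \<omega> N - s) \<le> (D + D) / real N"
      unfolding eventually_sequentially by blast
    show "(\<lambda>N. (D + D) / real N) \<longlonglongrightarrow> 0" by (rule lim_const_over_n)
  qed
  then show ?thesis by (simp add: LIM_zero_iff)
qed

lemma strong_nash_cone_plans:
  "strong_nash R S T P (cone_plan \<kappa> s) (cone_plan \<kappa> (prod.swap s)) s"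
  unfolding strong_nash_def
proof (intro conjI allI impI; elim conjE)
  fix M assume M: "play_law M"
    and X: "eventually_plays_X R S T P M (cone_plan \<kappa> s)"
    and Y: "eventually_plays_Y R S T P M (cone_plan \<kappa> (prod.swap s))"
  show "AE \<omega> in M. avg_payoff R S T P \<omega> \<longlonglongrightarrow> s"
    using AE_eventually_follows_X[OF M X] AE_eventually_follows_Y[OF M Y]
  proof eventually_elim
    case (elim \<omega>)
    from elim(1) obtain N1 where
      N1: "\<forall>N\<ge>N1. fst (\<omega> N) = Coop \<longleftrightarrow> guard \<kappa> (total \<omega> N) \<le> 0" ..
    from elim(2) obtain N2 where
      N2: "\<forall>N\<ge>N2. snd (\<omega> N) = Coop \<longleftrightarrow> guard \<kappa> (prod.swap (total \<omega> N)) \<le> 0" ..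
    show ?case by (rule both_plans_converge[of "max N1 N2"]) (use N1 N2 in simp_all)
  qed
next
  fix M assume M: "play_law M"
    and Y: "eventually_plays_Y R S T P M (cone_plan \<kappa> (prod.swap s))"
  show "AE \<omega> in M. \<forall>V. seq_limit_point (avg_payoff R S T P \<omega>) V \<and> fst V \<ge> fst s \<longrightarrow> V = s"
    using AE_eventually_follows_Y[OF M Y]
  proof eventually_elim
    case (elim \<omega>)
    then obtain N0 where
      "\<forall>N\<ge>N0. snd (\<omega> N) = Coop \<longleftrightarrow> guard \<kappa> (prod.swap (total \<omega> N)) \<le> 0" ..
    then show ?case using Y_plan_punishes[of N0 \<omega>] by simp
  qed
next
  fix M assume M: "play_law M"
    and X: "eventually_plays_X R S T P M (cone_plan \<kappa> s)"
  show "AE \<omega> in M. \<forall>V. seq_limit_point (avg_payoff R S T P \<omega>) V \<and> snd V \<ge> snd s \<longrightarrow> V = s"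
    using AE_eventually_follows_X[OF M X]
  proof eventually_elim
    case (elim \<omega>)
    then obtain N0 where
      "\<forall>N\<ge>N0. fst (\<omega> N) = Coop \<longleftrightarrow> guard \<kappa> (total \<omega> N) \<le> 0" ..
    then show ?case using X_plan_punishes[of N0 \<omega>] by simp
  qed
qed

end

lemma smale_plan_cone_plan: "smale_plan R S T P (cone_plan \<kappa> s)"
  by (simp add: smale_plan_def cone_plan_def)

theorem theorem4p13:
  fixes R S T P :: real and s :: "real \<times> real"
  assumes "T > R" and "R > P" and "P > S" and "2 * R > T + S"
    and "s \<in> payoff_region R S T P"
    and "P < fst s" and "P < snd s"
  shows "\<exists>\<pi>X \<pi>Y. smale_plan R S T P \<pi>X \<and> smale_plan R S T P \<pi>Y \<and>
           strong_nash R S T P \<pi>X \<pi>Y s"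
proof -
  \<comment> \<open>These are the steps in which a player defects, with that player's payoff first; the other
      player gets \<open>S\<close> or \<open>P\<close>, which is less than the target.\<close>
  let ?A = "{(T, S) - s, (P, P) - s, prod.swap ((S, T) - s), prod.swap ((P, P) - s)}"
  have "\<exists>\<kappa>. 0 < \<kappa> \<and> \<kappa> < 1 \<and> (\<forall>v\<in>?A. guard \<kappa> v \<le> 0)"
    by (rule small_slope_exists) (use assms in auto)
  then obtain \<kappa> where \<kappa>: "0 < \<kappa>" "\<kappa> < 1" "\<forall>v\<in>?A. guard \<kappa> v \<le> 0"
    by blast
  interpret guarded_target R S T P \<kappa> s
  proof
    show "guard \<kappa> (payoff R S T P (Defect, b) - s) \<le> 0" for b
      using \<kappa>(3) by (cases b) auto
    show "guard \<kappa> (prod.swap (payoff R S T P (a, Defect) - s)) \<le> 0" for a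
      using \<kappa>(3) by (cases a) auto
    have sure: "0 \<le> (T - S) * (2 * R - T - S)" "0 \<le> (T - S) * (R - P)"
      using assms by (auto intro!: mult_nonneg_nonneg)
    show "fst s * (R - S) + snd s * (T - R) \<le> (T - S) * R"
      by (rule payoff_region_le[OF assms(5)]) (use sure in \<open>simp_all add: algebra_simps\<close>)
    show "fst s * (T - R) + snd s * (R - S) \<le> (T - S) * R"
      by (rule payoff_region_le[OF assms(5)]) (use sure in \<open>simp_all add: algebra_simps\<close>)
  qed (use assms \<kappa> in auto)
  show ?thesis
    using strong_nash_cone_plans smale_plan_cone_plan by blast
qed

end
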